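(* For every $n\ge1$ and every finite set $A$, the inclusion $\mathscr G_n(A)\hookrightarrow\mathscr G_n^{\mathrm{ext}}(A)$ induces a weak homotopy equivalence of classifying spaces $|\mathscr G_n(A)|\to|\mathscr G_n^{\mathrm{ext}}(A)|$; hence the inclusion $|\mathscr G_n|\hookrightarrow|\mathscr G_n^{\mathrm{ext}}|$ is an equivalence of topological operads.
   Context: For a finite set $A$ and $n\ge1$, a weighted complete directed graph on $A$ assigns to each two-element subset $\{a,b\}\subseteq A$ exactly one directed edge, $a\to b$ or $b\to a$, together with a weight in $\{1,\dots,n\}$; write $a\xrightarrow{w}b$. Such graphs are ordered by: $g\le h$ iff for all $a\neq b$, whenever $a\xrightarrow{v}b$ in $g$, either $a\xrightarrow{w}b$ in $h$ with $v\le w$, or $b\xrightarrow{w}a$ in $h$ with $v<w$. $\mathscr G_n(A)$ is the subposet of acyclic such graphs (equivalently, the directions form a linear order on $A$); $\mathscr G_n^{\mathrm{ext}}(A)\supseteq\mathscr G_n(A)$ is the subposet of graphs containing no directed cycle all of whose edges have the same weight. Bijections act by relabelling vertices, and the operad composition $g\circ_a h$ (for $g$ on $A$, $h$ on $B$, $a\in A$) is the graph on $(A\setminus\{a\})\sqcup B$ whose edges among $A\setminus\{a\}$ are as in $g$, among $B$ are as in $h$, and whose edge between $a'\in A\setminus\{a\}$ and $b\in B$ has the direction and weight of the edge between $a'$ and $a$ in $g$ (with $a$ replaced by $b$). $|\cdot|$ denotes classifying spaces. *)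

theory Defs
  imports "HOL-Analysis.Analysis"
begin

text \<open>A weighted complete directed graph on A with weights in {1..n} is encoded as
  g :: 'a => 'a => nat, where g a b = w > 0 means the edge a -> b with weight w,
  and g a b = 0 means there is no edge a -> b.\<close>

definition wcdg :: "nat \<Rightarrow> 'a set \<Rightarrow> ('a \<Rightarrow> 'a \<Rightarrow> nat) \<Rightarrow> bool" where
  "wcdg n A g \<longleftrightarrow>
     (\<forall>a b. g a b \<noteq> 0 \<longrightarrow> a \<in> A \<and> b \<in> A \<and> a \<noteq> b \<and> g a b \<le> n) \<and>
     (\<forall>a\<in>A. \<forall>b\<in>A. a \<noteq> b \<longrightarrow> ((g a b \<noteq> 0) \<longleftrightarrow> g b a = 0))"

definition graph_le :: "('a \<Rightarrow> 'a \<Rightarrow> nat) \<Rightarrow> ('a \<Rightarrow> 'a \<Rightarrow> nat) \<Rightarrow> bool" where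
  "graph_le g h \<longleftrightarrow>
     (\<forall>a b. a \<noteq> b \<and> g a b \<noteq> 0 \<longrightarrow>
        (h a b \<noteq> 0 \<and> g a b \<le> h a b) \<or> (h b a \<noteq> 0 \<and> g a b < h b a))"

definition edges :: "('a \<Rightarrow> 'a \<Rightarrow> nat) \<Rightarrow> ('a \<times> 'a) set" where
  "edges g = {(a, b). g a b \<noteq> 0}"

definition edges_of_weight :: "('a \<Rightarrow> 'a \<Rightarrow> nat) \<Rightarrow> nat \<Rightarrow> ('a \<times> 'a) set" where
  "edges_of_weight g w = {(a, b). g a b \<noteq> 0 \<and> g a b = w}"

definition Gn :: "nat \<Rightarrow> 'a set \<Rightarrow> ('a \<Rightarrow> 'a \<Rightarrow> nat) set" where
  "Gn n A = {g. wcdg n A g \<and> acyclic (edges g)}"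

definition Gext :: "nat \<Rightarrow> 'a set \<Rightarrow> ('a \<Rightarrow> 'a \<Rightarrow> nat) set" where
  "Gext n A = {g. wcdg n A g \<and> (\<forall>w. acyclic (edges_of_weight g w))}"

text \<open>Geometric realization (classifying space) of a finite poset (P, le): the
  order complex, realized as the set of barycentric coordinate functions
  t : P -> [0,1] with sum 1 whose support is a chain, as a subspace of the
  product topology (which for a finite poset is the usual topology).\<close>
definition classifying_space :: "'b set \<Rightarrow> ('b \<Rightarrow> 'b \<Rightarrow> bool) \<Rightarrow> ('b \<Rightarrow> real) topology" where
  "classifying_space P le = subtopology (powertop_real UNIV)
     {t. (\<forall>x. t x \<noteq> 0 \<longrightarrow> x \<in> P) \<and> (\<forall>x. 0 \<le> t x) \<and> sum t P = 1 \<and>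
         (\<forall>x y. t x \<noteq> 0 \<and> t y \<noteq> 0 \<longrightarrow> le x y \<or> le y x)}"

definition sphere_base :: "nat \<Rightarrow> real" where
  "sphere_base = (\<lambda>i. if i = 0 then 1 else 0)"

definition weak_homotopy_equivalence ::
  "'x topology \<Rightarrow> 'y topology \<Rightarrow> ('x \<Rightarrow> 'y) \<Rightarrow> bool" where
  "weak_homotopy_equivalence X Y f \<longleftrightarrow>
     continuous_map X Y f \<and>
     (\<forall>y\<in>topspace Y. \<exists>x\<in>topspace X. path_component_of Y (f x) y) \<and>
     (\<forall>x\<in>topspace X. \<forall>x'\<in>topspace X.
         path_component_of Y (f x) (f x') \<longrightarrow> path_component_of X x x') \<and>
     (\<forall>k\<ge>1. \<forall>x\<in>topspace X.
        (\<forall>g. continuous_map (nsphere k) Y g \<and> g sphere_base = f x \<longrightarrow>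
           (\<exists>h. continuous_map (nsphere k) X h \<and> h sphere_base = x \<and>
                homotopic_with (\<lambda>m. m sphere_base = f x) (nsphere k) Y (f \<circ> h) g)) \<and>
        (\<forall>h h'. continuous_map (nsphere k) X h \<and> h sphere_base = x \<and>
                 continuous_map (nsphere k) X h' \<and> h' sphere_base = x \<and>
                 homotopic_with (\<lambda>m. m sphere_base = f x) (nsphere k) Y (f \<circ> h) (f \<circ> h')
           \<longrightarrow> homotopic_with (\<lambda>m. m sphere_base = x) (nsphere k) X h h'))"

end

theory Submission
  imports Defs
begin

text \<open>The order complex of \<open>Gn n A\<close> is even a strong deformation retract of that of \<open>Gext n A\<close>.
  By an inclusion version of Quillen's Theorem A it suffices that for each \<open>g\<close> in \<open>Gext n A\<close> the
  graphs \<open>h \<ge> g\<close> in \<open>Gn n A\<close> form a contractible poset. Send such an \<open>h\<close> to the set of vertices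
  without incoming edge of weight \<open>n\<close>. This is a nonempty subset of the corresponding set for \<open>g\<close>,
  and these subsets, ordered by reverse inclusion, form a poset with a minimum. The fibre over \<open>I\<close>
  consists of the \<open>h\<close> for which no edge of weight \<open>n\<close> ends in \<open>I\<close>. It is mapped by restriction to
  graphs on \<open>A - I\<close>, and then to graphs on \<open>I\<close> with weights below \<open>n\<close>; both targets are
  contractible by induction on \<open>n + card A\<close>, and the fibres that remain have a maximum, the ordinal
  sum of the two restrictions with all edges from \<open>I\<close> to \<open>A - I\<close> of weight \<open>n\<close>.\<close>

section \<open>Order complexes of finite posets\<close>

text \<open>The underlying set of \<open>classifying_space\<close>, taken as a subset of a function
  type with its product topology, so that it can be used with \<open>contractible\<close> and
  \<open>homotopic_with_canon\<close>.\<close>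

definition order_complex :: "'b set \<Rightarrow> ('b \<Rightarrow> 'b \<Rightarrow> bool) \<Rightarrow> ('b \<Rightarrow> real) set" where
  "order_complex P le = {t. (\<forall>x. t x \<noteq> 0 \<longrightarrow> x \<in> P) \<and> (\<forall>x. 0 \<le> t x) \<and> sum t P = 1 \<and>
         (\<forall>x y. t x \<noteq> 0 \<and> t y \<noteq> 0 \<longrightarrow> le x y \<or> le y x)}"

lemma classifying_space_eq: "classifying_space P le = top_of_set (order_complex P le)"
  unfolding classifying_space_def order_complex_def euclidean_product_topology ..

lemma order_complex_mono:
  assumes "finite Q" "P \<subseteq> Q"
  shows "order_complex P le \<subseteq> order_complex Q le"
proof
  fix t assume t: "t \<in> order_complex P le"
  then have "sum t Q = sum t P"
    using assms by (intro sum.mono_neutral_right) (auto simp: order_complex_def)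
  with t show "t \<in> order_complex Q le"
    using assms by (auto simp: order_complex_def)
qed

text \<open>Only comparability in either direction enters, so results on order complexes can be
  dualised.\<close>

lemma order_complex_converse: "order_complex P (\<lambda>x y. le y x) = order_complex P le"
  by (auto simp: order_complex_def)

lemma order_complex_le_one:
  assumes "finite P" "t \<in> order_complex P le"
  shows "t x \<le> 1"
proof (cases "x \<in> P")
  case True
  then have "t x \<le> sum t P"
    using assms by (intro member_le_sum) (auto simp: order_complex_def)
  then show ?thesis using assms by (auto simp: order_complex_def)
next
  case False
  then have "t x = 0" using assms by (auto simp: order_complex_def)
  then show ?thesis by simp
qed

section \<open>Strong deformation retracts and weak homotopy equivalences\<close>

text \<open>\<open>homotopic_with_canon\<close> imposes its predicate at every time of the homotopy,
  so points of \<open>T\<close> never move; in particular \<open>r\<close> is the identity on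
  \<open>T\<close>.\<close>

definition strong_deformation_retract :: "'a::topological_space set \<Rightarrow> 'a set \<Rightarrow> bool" where
  "strong_deformation_retract S T \<longleftrightarrow> T \<subseteq> S \<and>
     (\<exists>r. homotopic_with_canon (\<lambda>f. \<forall>x\<in>T. f x = x) S S id r \<and> r ` S \<subseteq> T)"

lemma strong_deformation_retract_refl: "strong_deformation_retract S S"
  unfolding strong_deformation_retract_def
  by (auto intro!: exI[of _ id])

text \<open>The homotopy from \<open>id\<close> to \<open>r\<close> is followed by the second
  deformation precomposed with \<open>r\<close>; every stage fixes \<open>U\<close>, since
  \<open>r\<close> is the identity on \<open>T\<close>.\<close>

lemma strong_deformation_retract_trans:
  assumes "strong_deformation_retract S T" "strong_deformation_retract T U"
  shows "strong_deformation_retract S U"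
proof -
  obtain r where r: "homotopic_with_canon (\<lambda>f. \<forall>x\<in>T. f x = x) S S id r" "r ` S \<subseteq> T" "T \<subseteq> S"
    using assms(1) unfolding strong_deformation_retract_def by blast
  obtain q where q: "homotopic_with_canon (\<lambda>f. \<forall>x\<in>U. f x = x) T T id q" "q ` T \<subseteq> U" "U \<subseteq> T"
    using assms(2) unfolding strong_deformation_retract_def by blast
  have fix_r: "r x = x" if "x \<in> T" for x
    using homotopic_with_imp_property[OF r(1)] that by blast
  have "continuous_on S r"
    using homotopic_with_imp_continuous[OF r(1)] by blast
  have "homotopic_with_canon (\<lambda>f. \<forall>x\<in>U. f x = x) T S id q"
    using homotopic_with_subset_right[OF q(1) r(3)] .
  then have "homotopic_with_canon (\<lambda>f. \<forall>x\<in>U. f x = x) S S (id \<circ> r) (q \<circ> r)"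
  proof (rule homotopic_with_compose_continuous_map_right)
    show "continuous_map (top_of_set S) (top_of_set T) r"
      using \<open>continuous_on S r\<close> r(2) by auto
  qed (use q(3) fix_r in auto)
  moreover have "homotopic_with_canon (\<lambda>f. \<forall>x\<in>U. f x = x) S S id (id \<circ> r)"
    unfolding id_comp by (rule homotopic_with_mono[OF r(1)]) (use q(3) in auto)
  ultimately have "homotopic_with_canon (\<lambda>f. \<forall>x\<in>U. f x = x) S S id (q \<circ> r)"
    by (meson homotopic_with_trans)
  moreover have "(q \<circ> r) ` S \<subseteq> U" using r(2) q(2) by auto
  ultimately show ?thesis
    unfolding strong_deformation_retract_def using r(3) q(3) by blast
qed

lemma strong_deformation_retract_contractible:
  assumes "strong_deformation_retract S T"
  shows "contractible S \<longleftrightarrow> contractible T"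
proof -
  obtain r where r: "homotopic_with_canon (\<lambda>f. \<forall>x\<in>T. f x = x) S S id r" "r ` S \<subseteq> T" "T \<subseteq> S"
    using assms(1) unfolding strong_deformation_retract_def by blast
  have fix_r: "r x = x" if "x \<in> T" for x
    using homotopic_with_imp_property[OF r(1)] that by blast
  have "continuous_on S r"
    using homotopic_with_imp_continuous[OF r(1)] by blast
  have "homotopic_with_canon (\<lambda>x. True) S S (id \<circ> r) id"
    unfolding id_comp by (rule homotopic_with_symD, rule homotopic_with_mono[OF r(1)]) simp
  moreover have "retraction_maps (top_of_set S) (top_of_set T) r id"
    using \<open>continuous_on S r\<close> r(2,3) fix_r by (auto simp: retraction_maps_def)
  ultimately have "top_of_set S homotopy_equivalent_space top_of_set T"
    by (rule deformation_retraction_imp_homotopy_equivalent_space)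
  then show ?thesis
    using homotopy_equivalent_space_contractibility contractible_space_top_of_set by blast
qed

lemma sphere_base_in_nsphere: "sphere_base \<in> topspace (nsphere k)"
proof -
  have "(\<Sum>i\<le>k. (sphere_base i)\<^sup>2) = (\<Sum>i\<le>k. if i = 0 then 1 else 0)"
    by (rule sum.cong) (auto simp: sphere_base_def)
  then show ?thesis
    by (auto simp: nsphere sphere_base_def)
qed

text \<open>The map \<open>r\<close> is a homotopy inverse of the inclusion. Since points of
  \<open>X\<close> never move, base points in \<open>X\<close> are respected throughout: a sphere
  \<open>g\<close> in \<open>Y\<close> is homotopic to \<open>r \<circ> g\<close> in
  \<open>X\<close>, and composing with \<open>r\<close> carries a based homotopy in \<open>Y\<close>
  back to \<open>X\<close>.\<close>

lemma strong_deformation_retract_weak_homotopy_equivalence: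
  fixes X Y :: "'a::topological_space set"
  assumes "strong_deformation_retract Y X"
  shows "weak_homotopy_equivalence (top_of_set X) (top_of_set Y) (\<lambda>t. t)"
proof -
  obtain r where r: "homotopic_with_canon (\<lambda>f. \<forall>x\<in>X. f x = x) Y Y id r" "r ` Y \<subseteq> X" "X \<subseteq> Y"
    using assms(1) unfolding strong_deformation_retract_def by blast
  have fix_r: "r x = x" if "x \<in> X" for x
    using homotopic_with_imp_property[OF r(1)] that by blast
  have cont_r: "continuous_on Y r"
    using homotopic_with_imp_continuous[OF r(1)] by blast
  have rYX: "continuous_map (top_of_set Y) (top_of_set X) r"
    using cont_r r(2) by auto
  obtain H where H: "continuous_map (prod_topology (top_of_set {0..1::real}) (top_of_set Y)) (top_of_set Y) H"
      "\<And>x. H (0, x) = x" "\<And>x. H (1, x) = r x"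
    using r(1) unfolding homotopic_with_def by auto
  have comp: "(\<lambda>t. t) \<circ> h = h" for h :: "(nat \<Rightarrow> real) \<Rightarrow> 'a" by auto
  have path: "path_component_of (top_of_set Y) (r y) y" if "y \<in> Y" for y
  proof -
    have "continuous_map (top_of_set {0..1}) (top_of_set Y) (H \<circ> (\<lambda>t. (t, y)))"
      by (rule continuous_map_compose[OF _ H(1)]) (use that in \<open>auto intro!: continuous_intros\<close>)
    then have "path_component_of (top_of_set Y) y (r y)"
      unfolding path_component_of_def pathin_def
      by (intro exI[of _ "H \<circ> (\<lambda>t. (t, y))"]) (simp add: H)
    then show ?thesis by (rule path_component_of_sym)
  qed
  have path': "path_component_of (top_of_set X) x x'"
    if x: "x \<in> X" "x' \<in> X" "path_component_of (top_of_set Y) x x'" for x x'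
  proof -
    from x(3) obtain g where "pathin (top_of_set Y) g" "g 0 = x" "g 1 = x'"
      unfolding path_component_of_def by (elim exE conjE)
    then have g: "continuous_map (top_of_set {0..1}) (top_of_set Y) g" "g 0 = x" "g 1 = x'"
      by (simp_all only: pathin_def)
    have "continuous_map (top_of_set {0..1}) (top_of_set X) (r \<circ> g)"
      using g(1) rYX by (rule continuous_map_compose)
    moreover have "(r \<circ> g) 0 = x" "(r \<circ> g) 1 = x'"
      using g fix_r x by auto
    ultimately show ?thesis
      unfolding path_component_of_def pathin_def by (intro exI[of _ "r \<circ> g"] conjI)
  qed
  have surj: "\<exists>h. continuous_map (nsphere k) (top_of_set X) h \<and> h sphere_base = x \<and>
                homotopic_with (\<lambda>m. m sphere_base = x) (nsphere k) (top_of_set Y) ((\<lambda>t. t) \<circ> h) g"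
    if "x \<in> X" and g: "continuous_map (nsphere k) (top_of_set Y) g" "g sphere_base = x" for k x g
  proof (intro exI conjI)
    show "continuous_map (nsphere k) (top_of_set X) (r \<circ> g)"
      using g(1) rYX by (rule continuous_map_compose)
    show "(r \<circ> g) sphere_base = x" using g that fix_r by simp
    have "homotopic_with (\<lambda>m. m sphere_base = x) (nsphere k) (top_of_set Y) (id \<circ> g) (r \<circ> g)"
      by (rule homotopic_with_compose_continuous_map_right[OF r(1) g(1)])
        (use g that in simp)
    then show "homotopic_with (\<lambda>m. m sphere_base = x) (nsphere k) (top_of_set Y)
        ((\<lambda>t. t) \<circ> (r \<circ> g)) g"
      by (subst homotopic_with_sym) (simp add: comp)
  qed
  have inj: "homotopic_with (\<lambda>m. m sphere_base = x) (nsphere k) (top_of_set X) h h'"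
    if "x \<in> X" and h: "continuous_map (nsphere k) (top_of_set X) h"
      and h': "continuous_map (nsphere k) (top_of_set X) h'"
      and hom: "homotopic_with (\<lambda>m. m sphere_base = x) (nsphere k) (top_of_set Y)
         ((\<lambda>t. t) \<circ> h) ((\<lambda>t. t) \<circ> h')" for k x h h'
  proof -
    have "homotopic_with (\<lambda>m. m sphere_base = x) (nsphere k) (top_of_set X)
       (r \<circ> ((\<lambda>t. t) \<circ> h)) (r \<circ> ((\<lambda>t. t) \<circ> h'))"
      by (rule homotopic_with_compose_continuous_map_left[OF hom rYX]) (use \<open>x \<in> X\<close> fix_r in simp)
    then show ?thesis
    proof (rule homotopic_with_eq)
      show "h z = (r \<circ> ((\<lambda>t. t) \<circ> h)) z" if "z \<in> topspace (nsphere k)" for z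
      proof -
        have "h z \<in> X"
          using continuous_map_image_subset_topspace[OF h] that
          by (simp only: topspace_euclidean_subtopology image_subset_iff)
        then show ?thesis using fix_r by simp
      qed
      show "h' z = (r \<circ> ((\<lambda>t. t) \<circ> h')) z" if "z \<in> topspace (nsphere k)" for z
      proof -
        have "h' z \<in> X"
          using continuous_map_image_subset_topspace[OF h'] that
          by (simp only: topspace_euclidean_subtopology image_subset_iff)
        then show ?thesis using fix_r by simp
      qed
    qed (simp add: sphere_base_in_nsphere)
  qed
  show ?thesis
    unfolding weak_homotopy_equivalence_def
  proof (intro conjI allI ballI impI)
    show "continuous_map (top_of_set X) (top_of_set Y) (\<lambda>t. t)"
      using r(3) by auto
    show "\<exists>x\<in>topspace (top_of_set X). path_component_of (top_of_set Y) x y"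
      if "y \<in> topspace (top_of_set Y)" for y
      using that path r(2) by (intro bexI[of _ "r y"]) auto
    show "path_component_of (top_of_set X) x x'"
      if "x \<in> topspace (top_of_set X)" "x' \<in> topspace (top_of_set X)"
        "path_component_of (top_of_set Y) x x'" for x x'
      using that by (intro path') (simp_all only: topspace_euclidean_subtopology)
    show "\<exists>h. continuous_map (nsphere k) (top_of_set X) h \<and> h sphere_base = x \<and>
                homotopic_with (\<lambda>m. m sphere_base = x) (nsphere k) (top_of_set Y) ((\<lambda>t. t) \<circ> h) g"
      if "x \<in> topspace (top_of_set X)"
        "continuous_map (nsphere k) (top_of_set Y) g \<and> g sphere_base = x" for k x g
      using that by (intro surj) (simp_all only: topspace_euclidean_subtopology)
    show "homotopic_with (\<lambda>m. m sphere_base = x) (nsphere k) (top_of_set X) h h'"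
      if "x \<in> topspace (top_of_set X)"
        "continuous_map (nsphere k) (top_of_set X) h \<and> h sphere_base = x \<and>
         continuous_map (nsphere k) (top_of_set X) h' \<and> h' sphere_base = x \<and>
         homotopic_with (\<lambda>m. m sphere_base = x) (nsphere k) (top_of_set Y)
           ((\<lambda>t. t) \<circ> h) ((\<lambda>t. t) \<circ> h')" for k x h h'
      using that by (elim conjE, intro inj) (simp_all only: topspace_euclidean_subtopology)
  qed
qed

section \<open>Deleting a vertex from an order complex\<close>

text \<open>The part of \<open>D\<close> where \<open>\<phi>\<close> is positive is open in
  \<open>D\<close>, so limits at \<open>z\<close> may be computed inside it. This permits a
  continuity proof with a different formula for the map near each point.\<close>

lemma tendsto_within_positive_part:
  fixes \<phi> :: "'a::topological_space \<Rightarrow> real" and f :: "'a \<Rightarrow> 'b::topological_space"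
  assumes "continuous_on D \<phi>" "z \<in> D" "\<phi> z > 0" and f: "continuous_on {w\<in>D. \<phi> w > 0} f"
  shows "(f \<longlongrightarrow> f z) (at z within D)"
proof -
  have "openin (top_of_set D) (D \<inter> \<phi> -` {0<..})"
    by (intro continuous_openin_preimage_gen assms) auto
  then obtain V where V: "open V" "D \<inter> \<phi> -` {0<..} = D \<inter> V"
    by (auto simp: openin_open)
  have "at z within D = at z within {w\<in>D. \<phi> w > 0}"
    by (rule at_within_nhd[of _ V]) (use V assms in auto)
  then show ?thesis
    using f assms(2,3) by (simp add: continuous_on_def)
qed

text \<open>The contraction of the upper part is run on \<open>[0,1/2]\<close> only, so that it is constant for
  parameters near \<open>1\<close>; this keeps the deformation continuous where the upper part has mass \<open>0\<close>.\<close>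

lemma order_complex_remove_point:
  fixes le :: "'b \<Rightarrow> 'b \<Rightarrow> bool"
  assumes fin: "finite Q" and refl: "\<And>x. x \<in> Q \<Longrightarrow> le x x"
    and trans: "\<And>x y z. \<lbrakk>x \<in> Q; y \<in> Q; z \<in> Q; le x y; le y z\<rbrakk> \<Longrightarrow> le x z"
    and "g \<in> Q" and ne: "{x\<in>Q. le g x \<and> x \<noteq> g} \<noteq> {}"
    and ctr: "contractible (order_complex {x\<in>Q. le g x \<and> x \<noteq> g} le)"
  shows "strong_deformation_retract (order_complex Q le) (order_complex (Q - {g}) le)"
proof -
  define U where "U = {x\<in>Q. le g x \<and> x \<noteq> g}"
  define K where "K = order_complex Q le"
  define L where "L = order_complex U le"
  have UQ: "U \<subseteq> Q" "finite U" "g \<notin> U" using fin by (auto simp: U_def)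
  \<comment> \<open>A contraction of the upper link \<open>L\<close> of \<open>g\<close> to the
    point \<open>p\<close>. The equations \<open>h0\<close> and \<open>h1\<close> hold for all
    arguments, also outside \<open>L\<close>.\<close>
  obtain h :: "real \<times> ('b \<Rightarrow> real) \<Rightarrow> 'b \<Rightarrow> real" and p
    where h: "continuous_on ({0..1} \<times> L) h" "h ` ({0..1} \<times> L) \<subseteq> L"
      and h0: "\<And>v. h (0, v) = v" and h1: "\<And>v. h (1, v) = p"
    using ctr unfolding contractible_def homotopic_with_def U_def[symmetric] L_def[symmetric]
    by (auto simp: image_subset_iff_funcset)
  obtain u0 where "u0 \<in> U" using ne U_def by blast
  then have "(\<lambda>x. if x = u0 then 1 else 0) \<in> L"
    using UQ refl by (auto simp: L_def order_complex_def)
  then have pL: "p \<in> L" using h(2) h1 by force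
  \<comment> \<open>In the first half of the time the normalised upper part \<open>nrm t\<close> is
    moved along the contraction, the further the larger \<open>t g\<close> is compared with
    \<open>m t\<close>. In the second half the mass of \<open>g\<close> is moved into
    \<open>U\<close>; \<open>\<mu> s\<close> is the fraction moved and \<open>E s t\<close> the
    resulting mass of \<open>U\<close>. The contraction time \<open>\<rho> s t\<close> is 0 if
    \<open>s = 0\<close> or \<open>t g = 0\<close>, and it is 1 if \<open>s\<close> is at least 1/2
    and \<open>t g\<close> is positive and at least \<open>m t\<close>.\<close>
  define m where "m t = sum t U" for t :: "'b \<Rightarrow> real"
  define \<mu> where "\<mu> s = max 0 (2 * s - 1)" for s :: real
  define \<rho> where "\<rho> s t = min 1 (2 * (min 1 (2 * s) * (t g / (t g + m t))))" for s :: real and t :: "'b \<Rightarrow> real"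
  define nrm where "nrm t = (\<lambda>y. if y \<in> U then t y / m t else 0)" for t :: "'b \<Rightarrow> real"
  define E where "E s t = m t + \<mu> s * t g" for s t
  define H where "H = (\<lambda>(s, t) x. if x \<in> U then E s t * h (\<rho> s t, nrm t) x
      else if x = g then (1 - \<mu> s) * t g else t x)"
  have tpos: "t x \<ge> 0" if "t \<in> K" for t x
    using that by (simp add: K_def order_complex_def)
  have m0: "m t \<ge> 0" if "t \<in> K" for t
    using tpos that by (simp add: m_def sum_nonneg)
  have mzero: "t x = 0" if "t \<in> K" "m t = 0" "x \<in> U" for t x
    using that tpos[OF that(1)] UQ(2) by (simp add: m_def sum_nonneg_eq_0_iff)
  have \<mu>01: "0 \<le> \<mu> s" "\<mu> s \<le> 1" if "s \<in> {0..1}" for s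
    using that by (auto simp: \<mu>_def)
  have E0: "E s t \<ge> 0" if "s \<in> {0..1}" "t \<in> K" for s t
    using m0 \<mu>01 tpos that by (simp add: E_def)
  have \<rho>01: "\<rho> s t \<in> {0..1}" if "s \<in> {0..1}" "t \<in> K" for s t
    using m0[OF that(2)] tpos[OF that(2)] that(1) by (auto simp: \<rho>_def)
  have nrmL: "nrm t \<in> L" if t: "t \<in> K" "m t > 0" for t
  proof -
    have "sum (nrm t) U = sum t U / m t"
      unfolding nrm_def by (simp add: sum_divide_distrib)
    then show ?thesis
      using that tpos[OF t(1)] unfolding L_def K_def order_complex_def
      by (auto simp: nrm_def m_def split: if_splits)
  qed
  have \<rho>1: "\<rho> s t = 1" if "1/2 < s" "m t < t g" "t \<in> K" for s t
  proof -
    have "t g > 0" "m t \<ge> 0" using m0[OF that(3)] that by auto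
    then have "t g / (t g + m t) \<ge> 1/2" using that by (simp add: field_simps)
    then show ?thesis using that by (simp add: \<rho>_def min_def mult.commute)
  qed
  have hL: "h (\<rho> s t, nrm t) \<in> L" if "s \<in> {0..1}" "t \<in> K" "E s t > 0" for s t
  proof (cases "m t > 0")
    case True
    then show ?thesis using h(2) nrmL \<rho>01 that by blast
  next
    \<comment> \<open>With no mass on \<open>U\<close> the function \<open>nrm t\<close> is zero and
      lies outside \<open>L\<close>, but the contraction has then run to its end and gives
      \<open>p\<close>.\<close>
    case False
    then have "m t = 0" using m0 that by force
    then have "\<mu> s * t g > 0" using that by (simp add: E_def)
    then have "t g > 0" "\<mu> s > 0"
      using tpos[OF that(2), of g] \<mu>01[OF that(1)] by (auto simp: zero_less_mult_iff)
    then have "\<rho> s t = 1" using that \<open>m t = 0\<close> by (intro \<rho>1) (auto simp: \<mu>_def split: if_splits)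
    then show ?thesis using h1 pL by simp
  qed
  \<comment> \<open>Where \<open>g\<close> has no mass, the contraction time is 0 and there is
    nothing to move. This is what makes the deformation rest on the smaller complex.\<close>
  have Hg: "H (s, t) = t" if "t \<in> K" "t g = 0" for s t
  proof
    fix x show "H (s, t) x = t x"
      using that mzero[OF that(1)] by (auto simp: H_def E_def \<rho>_def h0 nrm_def)
  qed
  have H0: "H (0, t) = t" if "t \<in> K" for t
  proof
    fix x show "H (0, t) x = t x"
      using that mzero[OF that(1)] by (auto simp: H_def E_def \<rho>_def h0 nrm_def \<mu>_def)
  qed
  have HK: "H (s, t) \<in> K" if s: "s \<in> {0..1}" and t: "t \<in> K" for s t
  proof (cases "t g = 0")
    case True
    then show ?thesis using Hg t by simp
  next
    case False
    let ?k = "h (\<rho> s t, nrm t)"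
    \<comment> \<open>As \<open>t g\<close> is nonzero, the support of \<open>t\<close> is a chain
      through \<open>g\<close>, so what lies outside \<open>U\<close> is at most \<open>g\<close>
      and hence below all of \<open>U\<close>. The new part in \<open>U\<close> may therefore be any
      chain.\<close>
    have supp: "x \<in> Q \<and> (x \<in> U \<and> ?k x \<noteq> 0 \<or> x \<notin> U \<and> t x \<noteq> 0 \<and> le x g)" if "H (s, t) x \<noteq> 0" for x
    proof (cases "x \<in> U")
      case True
      then show ?thesis using that UQ by (auto simp: H_def)
    next
      case F: False
      then have "t x \<noteq> 0" using that by (auto simp: H_def split: if_splits)
      then have "x \<in> Q" "le x g \<or> le g x" using t False by (auto simp: K_def order_complex_def)
      then show ?thesis using F \<open>t x \<noteq> 0\<close> refl \<open>g \<in> Q\<close> by (auto simp: U_def)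
    qed
    have supp': "E s t > 0" if "H (s, t) x \<noteq> 0" "x \<in> U" for x
      using that E0[OF s t] by (auto simp: H_def)
    have "sum (H (s, t)) Q = sum (H (s, t)) U + sum (H (s, t)) (Q - U)"
      using UQ fin by (metis add.commute sum.subset_diff)
    also have "sum (H (s, t)) (Q - U) = sum (H (s, t)) (Q - U - {g}) + H (s, t) g"
      using UQ fin \<open>g \<in> Q\<close> by (subst sum.remove[of _ g]) auto
    also have "sum (H (s, t)) (Q - U - {g}) = sum t (Q - U - {g})"
      by (rule sum.cong) (auto simp: H_def)
    also have "sum (H (s, t)) U = E s t * sum ?k U"
      by (simp add: H_def sum_distrib_left)
    also have "\<dots> = E s t"
    proof (cases "E s t > 0")
      case True
      then show ?thesis using hL[OF s t True] by (simp add: L_def order_complex_def)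
    next
      case F: False
      then show ?thesis using E0[OF s t] by simp
    qed
    also have "E s t + (sum t (Q - U - {g}) + H (s, t) g) = sum t U + (sum t (Q - U - {g}) + t g)"
      using UQ by (simp add: H_def E_def m_def algebra_simps)
    also have "sum t (Q - U - {g}) + t g = sum t (Q - U)"
      using UQ fin \<open>g \<in> Q\<close> by (subst (2) sum.remove[of _ g]) auto
    also have "sum t U + sum t (Q - U) = sum t Q"
      using UQ fin by (metis add.commute sum.subset_diff)
    finally have "sum (H (s, t)) Q = 1" using t by (simp add: K_def order_complex_def)
    moreover have "H (s, t) x \<ge> 0" for x
    proof (cases "x \<in> U \<and> E s t > 0")
      case True
      then have "?k x \<ge> 0" using hL[OF s t] by (simp add: L_def order_complex_def)
      then show ?thesis using True by (simp add: H_def)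
    next
      case F: False
      then show ?thesis using E0[OF s t] \<mu>01[OF s] tpos[OF t] by (auto simp: H_def)
    qed
    moreover have "le x y \<or> le y x" if "H (s, t) x \<noteq> 0" "H (s, t) y \<noteq> 0" for x y
    proof -
      consider "x \<in> U" "y \<in> U" | "x \<in> U" "y \<notin> U" | "x \<notin> U" "y \<in> U" | "x \<notin> U" "y \<notin> U" by blast
      then show ?thesis
      proof cases
        case 1
        then show ?thesis
          using supp[OF that(1)] supp[OF that(2)] hL[OF s t supp'[OF that(1)]]
          by (auto simp: L_def order_complex_def)
      next
        case 2
        then have "le y g" "le g x" "x \<in> Q" "y \<in> Q" using supp[OF that(2)] by (auto simp: U_def)
        then show ?thesis using trans \<open>g \<in> Q\<close> by blast
      next
        case 3
        then have "le x g" "le g y" "x \<in> Q" "y \<in> Q" using supp[OF that(1)] by (auto simp: U_def)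
        then show ?thesis using trans \<open>g \<in> Q\<close> by blast
      next
        case 4
        then show ?thesis
          using supp[OF that(1)] supp[OF that(2)] t by (auto simp: K_def order_complex_def)
      qed
    qed
    ultimately show ?thesis using supp by (simp add: K_def order_complex_def)
  qed
  have H1: "H (1, t) \<in> order_complex (Q - {g}) le" if t: "t \<in> K" for t
  proof -
    have "H (1, t) \<in> K" "H (1, t) g = 0" using HK t UQ by (auto simp: H_def \<mu>_def)
    then show ?thesis
      using fin \<open>g \<in> Q\<close> by (auto simp: K_def order_complex_def sum_diff1)
  qed
  have cont: "continuous_on ({0..1} \<times> K) H"
  proof (rule continuous_on_coordinatewise_then_product)
    fix x
    let ?D = "{0..1::real} \<times> K"
    have coord: "continuous_on S (\<lambda>z. snd z y)" for S :: "(real \<times> ('b \<Rightarrow> real)) set" and y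
      by (rule continuous_on_compose2[OF continuous_on_product_coordinates continuous_on_snd])
        (auto intro: continuous_intros)
    have cm: "continuous_on S (\<lambda>z. m (snd z))" for S :: "(real \<times> ('b \<Rightarrow> real)) set"
      unfolding m_def by (intro continuous_intros coord)
    have c\<mu>: "continuous_on S (\<lambda>z. \<mu> (fst z))" for S :: "(real \<times> ('b \<Rightarrow> real)) set"
      unfolding \<mu>_def by (intro continuous_intros)
    have cE: "continuous_on S (\<lambda>z. E (fst z) (snd z))" for S :: "(real \<times> ('b \<Rightarrow> real)) set"
      unfolding E_def by (intro continuous_intros coord cm c\<mu>)
    let ?f = "\<lambda>z. E (fst z) (snd z) * h (\<rho> (fst z) (snd z), nrm (snd z)) x"
    \<comment> \<open>Three cases at \<open>(s, t)\<close>. If \<open>E s t = 0\<close>, the factor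
      from \<open>h\<close> is at most 1 wherever \<open>E\<close> is positive, and \<open>E\<close>
      squeezes the product to 0. If \<open>m t > 0\<close>, normalisation is continuous nearby. If
      \<open>m t = 0\<close> but \<open>E s t > 0\<close>, then \<open>s > 1/2\<close> and
      \<open>t g > m t\<close>; both persist nearby and make the factor from \<open>h\<close>
      constantly \<open>p x\<close>.\<close>
    have "continuous_on ?D ?f" if "x \<in> U"
      unfolding continuous_on_def
    proof
      fix z assume z: "z \<in> ?D"
      obtain s t where st: "z = (s, t)" "s \<in> {0..1}" "t \<in> K" using z by blast
      show "(?f \<longlongrightarrow> ?f z) (at z within ?D)"
      proof (cases "E s t > 0")
        case False
        then have E: "E s t = 0" using E0 st by force
        have "((\<lambda>z. E (fst z) (snd z)) \<longlongrightarrow> 0) (at z within ?D)"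
          using cE[of ?D] z st E unfolding continuous_on_def by force
        moreover have bound: "norm (?f w) \<le> E (fst w) (snd w)" if "w \<in> ?D" for w
        proof (cases "E (fst w) (snd w) > 0")
          case True
          have "h (\<rho> (fst w) (snd w), nrm (snd w)) \<in> L"
            using that True by (intro hL) auto
          then have "\<bar>h (\<rho> (fst w) (snd w), nrm (snd w)) x\<bar> \<le> 1"
            using order_complex_le_one[OF UQ(2)] by (auto simp: L_def order_complex_def abs_le_iff intro: order_trans[of _ 0])
          then show ?thesis using True by (simp add: abs_mult mult_left_le)
        next
          case F: False
          then have "E (fst w) (snd w) = 0" using E0[of "fst w" "snd w"] that by force
          then show ?thesis by simp
        qed
        moreover have "\<forall>\<^sub>F w in at z within ?D. norm (?f w) \<le> E (fst w) (snd w)"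
          unfolding eventually_at_filter by (rule always_eventually) (use bound in blast)
        ultimately have "(?f \<longlongrightarrow> 0) (at z within ?D)"
          by (rule_tac Lim_null_comparison)
        then show ?thesis using st E by simp
      next
        case Epos: True
        show ?thesis
        proof (cases "m t > 0")
          case True
          let ?S = "{w\<in>?D. m (snd w) > 0}"
          have pos: "snd w g + m (snd w) > 0" if "w \<in> ?S" for w
            using that tpos[of "snd w" g] by (auto simp: add_nonneg_pos)
          have c1: "continuous_on ?S (\<lambda>w. \<rho> (fst w) (snd w))"
            unfolding \<rho>_def using pos by (intro continuous_intros coord cm) force
          have c2: "continuous_on ?S (\<lambda>w. nrm (snd w))"
          proof (rule continuous_on_coordinatewise_then_product)
            show "continuous_on ?S (\<lambda>w. nrm (snd w) y)" for y
              unfolding nrm_def by (cases "y \<in> U") (auto intro!: continuous_intros coord cm)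
          qed
          have "continuous_on ?S (\<lambda>w. h (\<rho> (fst w) (snd w), nrm (snd w)))"
            using \<rho>01 nrmL
            by (intro continuous_on_compose2[OF h(1)] continuous_on_Pair c1 c2) auto
          then have "continuous_on ?S (\<lambda>w. h (\<rho> (fst w) (snd w), nrm (snd w)) x)"
            by (rule continuous_on_product_then_coordinatewise)
          then have "continuous_on ?S ?f"
            by (intro continuous_on_mult cE)
          then show ?thesis
            using True st z by (intro tendsto_within_positive_part[OF cm]) auto
        next
          case False
          then have "m t = 0" using m0 st by force
          then have "\<mu> s * t g > 0" using Epos by (simp add: E_def)
          then have tg: "t g > 0" "\<mu> s > 0"
            using tpos[OF st(3), of g] \<mu>01[OF st(2)] by (auto simp: zero_less_mult_iff)
          then have s: "s > 1/2" by (auto simp: \<mu>_def split: if_splits)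
          let ?\<phi> = "\<lambda>w. min (fst w - 1/2) (snd w g - m (snd w))"
          have c\<phi>: "continuous_on ?D ?\<phi>" by (intro continuous_intros coord cm)
          have "continuous_on {w\<in>?D. ?\<phi> w > 0} (\<lambda>w. E (fst w) (snd w) * p x)"
            by (intro continuous_intros cE)
          moreover have "E (fst w) (snd w) * p x = ?f w" if "w \<in> {w\<in>?D. ?\<phi> w > 0}" for w
            using that \<rho>1[of "fst w" "snd w"] h1 by auto
          ultimately have "continuous_on {w\<in>?D. ?\<phi> w > 0} ?f"
            by (rule continuous_on_eq) auto
          then show ?thesis
            using s tg \<open>m t = 0\<close> st z by (intro tendsto_within_positive_part[OF c\<phi>]) auto
        qed
      qed
    qed
    moreover have "continuous_on ?D (\<lambda>z. (1 - \<mu> (fst z)) * snd z g)"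
      by (intro continuous_intros coord c\<mu>)
    ultimately show "continuous_on ?D (\<lambda>z. H z x)"
      using coord by (cases "x \<in> U"; cases "x = g") (simp_all add: H_def case_prod_beta)
  qed
  have sub: "order_complex (Q - {g}) le \<subseteq> K"
    unfolding K_def by (rule order_complex_mono) (use fin in auto)
  have "homotopic_with_canon (\<lambda>f. \<forall>x\<in>order_complex (Q - {g}) le. f x = x) K K id (\<lambda>t. H (1, t))"
  proof (subst homotopic_with)
    show "\<exists>k. continuous_map (prod_topology (top_of_set {0..1::real}) (top_of_set K)) (top_of_set K) k \<and>
        (\<forall>x\<in>topspace (top_of_set K). k (0, x) = id x) \<and>
        (\<forall>x\<in>topspace (top_of_set K). k (1, x) = H (1, x)) \<and>
        (\<forall>t\<in>{0..1}. \<forall>x\<in>order_complex (Q - {g}) le. k (t, x) = x)"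
    proof (intro exI[of _ H] conjI)
      show "continuous_map (prod_topology (top_of_set {0..1}) (top_of_set K)) (top_of_set K) H"
        using cont HK by auto
      have "x g = 0" if "x \<in> order_complex (Q - {g}) le" for x
        using that by (auto simp: order_complex_def)
      then show "\<forall>t\<in>{0..1}. \<forall>x\<in>order_complex (Q - {g}) le. H (t, x) = x"
        using Hg sub by auto
    qed (use H0 in auto)
  qed (simp, metis sub subsetD)
  then show ?thesis
    unfolding strong_deformation_retract_def K_def[symmetric] using sub H1 by blast
qed

section \<open>Inclusions of finite posets\<close>

definition poset_on :: "'b set \<Rightarrow> ('b \<Rightarrow> 'b \<Rightarrow> bool) \<Rightarrow> bool" where
  "poset_on P le \<longleftrightarrow> (\<forall>x\<in>P. le x x) \<and> (\<forall>x\<in>P. \<forall>y\<in>P. le x y \<and> le y x \<longrightarrow> x = y) \<and>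
     (\<forall>x\<in>P. \<forall>y\<in>P. \<forall>z\<in>P. le x y \<and> le y z \<longrightarrow> le x z)"

lemma poset_on_refl: "poset_on P le \<Longrightarrow> x \<in> P \<Longrightarrow> le x x"
  by (simp add: poset_on_def)

lemma poset_on_antisym: "poset_on P le \<Longrightarrow> x \<in> P \<Longrightarrow> y \<in> P \<Longrightarrow> le x y \<Longrightarrow> le y x \<Longrightarrow> x = y"
  unfolding poset_on_def by blast

lemma poset_on_trans:
  "poset_on P le \<Longrightarrow> x \<in> P \<Longrightarrow> y \<in> P \<Longrightarrow> z \<in> P \<Longrightarrow> le x y \<Longrightarrow> le y z \<Longrightarrow> le x z"
  unfolding poset_on_def by blast

lemma poset_on_subset: "poset_on Q le \<Longrightarrow> P \<subseteq> Q \<Longrightarrow> poset_on P le"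
  unfolding poset_on_def by blast

lemma poset_on_converse: "poset_on Q le \<Longrightarrow> poset_on Q (\<lambda>x y. le y x)"
  unfolding poset_on_def by blast

text \<open>Nonemptiness is required separately, because the empty set counts as
  \<open>contractible\<close>.\<close>

definition contractible_poset :: "'b set \<Rightarrow> ('b \<Rightarrow> 'b \<Rightarrow> bool) \<Rightarrow> bool" where
  "contractible_poset P le \<longleftrightarrow> P \<noteq> {} \<and> contractible (order_complex P le)"

lemma contractible_poset_converse:
  "contractible_poset P (\<lambda>x y. le y x) \<longleftrightarrow> contractible_poset P le"
  unfolding contractible_poset_def order_complex_converse[of P le] ..

text \<open>Elements of \<open>Q - P\<close> are deleted one by one, always a maximal one:
  everything strictly above it lies in \<open>P\<close>, so its upper link is one of the sets
  assumed contractible.\<close>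

lemma poset_inclusion_strong_deformation_retract:
  assumes "finite Q" "poset_on Q le" "P \<subseteq> Q"
    and "\<And>g. g \<in> Q - P \<Longrightarrow> contractible_poset {x\<in>P. le g x} le"
  shows "strong_deformation_retract (order_complex Q le) (order_complex P le)"
  using assms
proof (induction "card (Q - P)" arbitrary: Q)
  case 0
  then have "Q - P = {}" by (metis card_0_eq finite_Diff)
  then have "Q = P" using "0.prems"(3) by blast
  then show ?case by (simp add: strong_deformation_retract_refl)
next
  case (Suc k)
  let ?lt = "\<lambda>x y. le x y \<and> x \<noteq> y"
  have "Q - P \<noteq> {}" using Suc.hyps(2) by (metis card.empty nat.distinct(1))
  moreover have "finite (Q - P)" using Suc.prems(1) by simp
  moreover have "asymp_on (Q - P) ?lt"
    using poset_on_antisym[OF Suc.prems(2)] by (auto intro!: asymp_onI)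
  moreover have "transp_on (Q - P) ?lt"
    using poset_on_antisym[OF Suc.prems(2)] poset_on_trans[OF Suc.prems(2)]
    by (intro transp_onI) (metis DiffD1)
  ultimately obtain g where g: "g \<in> Q - P" and max: "\<And>x. x \<in> Q - P \<Longrightarrow> x \<noteq> g \<Longrightarrow> \<not> le g x"
    using Finite_Set.bex_max_element[of "Q - P" ?lt] by metis
  have up: "{x\<in>Q. le g x \<and> x \<noteq> g} = {x\<in>P. le g x}"
    using g max Suc.prems(3) by blast
  have "strong_deformation_retract (order_complex Q le) (order_complex (Q - {g}) le)"
    using Suc.prems(4)[OF g] g Suc.prems(1)
    by (intro order_complex_remove_point)
      (auto simp: up contractible_poset_def intro: poset_on_refl[OF Suc.prems(2)] poset_on_trans[OF Suc.prems(2)])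
  moreover have "strong_deformation_retract (order_complex (Q - {g}) le) (order_complex P le)"
  proof (rule Suc.hyps(1))
    have "Q - {g} - P = (Q - P) - {g}" by blast
    then show "k = card (Q - {g} - P)"
      using Suc.hyps(2) g Suc.prems(1) by (simp add: card_Diff_singleton)
    show "poset_on (Q - {g}) le" using Suc.prems(2) by (rule poset_on_subset) blast
  qed (use Suc.prems g in auto)
  ultimately show ?case by (rule strong_deformation_retract_trans)
qed

lemma poset_inclusion_strong_deformation_retract_dual:
  assumes "finite Q" "poset_on Q le" "P \<subseteq> Q"
    and "\<And>g. g \<in> Q - P \<Longrightarrow> contractible_poset {x\<in>P. le x g} le"
  shows "strong_deformation_retract (order_complex Q le) (order_complex P le)"
proof -
  have "contractible_poset {x\<in>P. le x g} (\<lambda>x y. le y x)" if "g \<in> Q - P" for g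
    using assms(4)[OF that] unfolding contractible_poset_converse[of _ le] .
  then have "strong_deformation_retract (order_complex Q (\<lambda>x y. le y x))
      (order_complex P (\<lambda>x y. le y x))"
    by (rule poset_inclusion_strong_deformation_retract[OF assms(1) poset_on_converse[OF assms(2)] assms(3)])
  then show ?thesis unfolding order_complex_converse[of _ le] .
qed

section \<open>Cones and isomorphic posets\<close>

text \<open>The order complex is a cone with apex the vertex \<open>m\<close>: adding
  \<open>m\<close> to a chain gives a chain, so straight lines to the apex stay inside.\<close>

lemma contractible_poset_maximum:
  assumes fin: "finite P" and "m \<in> P" and top: "\<And>x. x \<in> P \<Longrightarrow> le x m"
  shows "contractible_poset P le"
proof -
  let ?K = "order_complex P le"
  define e where "e = (\<lambda>x. if x = m then 1 else 0::real)"
  define H where "H = (\<lambda>(s::real, t) x. (1 - s) * t x + s * e x)"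
  have coord: "continuous_on S (\<lambda>z. snd z y)" for S :: "(real \<times> ('a \<Rightarrow> real)) set" and y
    by (rule continuous_on_compose2[OF continuous_on_product_coordinates continuous_on_snd])
      (auto intro: continuous_intros)
  have "continuous_on ({0..1} \<times> ?K) H"
  proof (rule continuous_on_coordinatewise_then_product)
    show "continuous_on ({0..1} \<times> ?K) (\<lambda>z. H z y)" for y
      unfolding H_def case_prod_beta by (intro continuous_intros coord)
  qed
  moreover have "H (s, t) \<in> ?K" if s: "s \<in> {0..1}" and t: "t \<in> ?K" for s t
  proof -
    have "sum (H (s, t)) P = (1 - s) * sum t P + s * sum e P"
      by (simp add: H_def sum.distrib sum_distrib_left)
    also have "sum e P = 1" using fin \<open>m \<in> P\<close> by (simp add: e_def)
    finally have "sum (H (s, t)) P = 1" using t by (simp add: order_complex_def)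
    moreover have nz: "t x \<noteq> 0 \<or> x = m" if "H (s, t) x \<noteq> 0" for x
      using that by (auto simp: H_def e_def split: if_splits)
    moreover have "H (s, t) x \<ge> 0" for x
      using s t by (auto simp: H_def e_def order_complex_def)
    moreover have "le x y \<or> le y x" if "H (s, t) x \<noteq> 0" "H (s, t) y \<noteq> 0" for x y
      using nz[OF that(1)] nz[OF that(2)] t top \<open>m \<in> P\<close> by (auto simp: order_complex_def)
    moreover have "x \<in> P" if "H (s, t) x \<noteq> 0" for x
      using nz[OF that] t \<open>m \<in> P\<close> by (auto simp: order_complex_def)
    ultimately show ?thesis by (simp add: order_complex_def)
  qed
  ultimately have "homotopic_with_canon (\<lambda>x. True) ?K ?K id (\<lambda>x. e)"
    unfolding homotopic_with_def by (intro exI[of _ H]) (auto simp: H_def)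
  then show ?thesis
    using \<open>m \<in> P\<close> unfolding contractible_poset_def contractible_def by auto
qed

lemma contractible_poset_minimum:
  assumes "finite P" "m \<in> P" "\<And>x. x \<in> P \<Longrightarrow> le m x"
  shows "contractible_poset P le"
  using contractible_poset_maximum[of P m "\<lambda>x y. le y x", OF assms]
  unfolding contractible_poset_converse[of P le] .

lemma order_complex_iso:
  assumes inj: "inj_on f P" and le: "\<And>x y. x \<in> P \<Longrightarrow> y \<in> P \<Longrightarrow> le' (f x) (f y) \<longleftrightarrow> le x y"
  shows "top_of_set (order_complex P le) homeomorphic_space top_of_set (order_complex (f ` P) le')"
proof -
  let ?K = "order_complex P le" and ?L = "order_complex (f ` P) le'"
  define F where "F t = (\<lambda>y. if y \<in> f ` P then t (inv_into P f y) else 0)" for t :: "'a \<Rightarrow> real"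
  define G where "G t = (\<lambda>x. if x \<in> P then t (f x) else 0)" for t :: "'b \<Rightarrow> real"
  have Ff: "F t (f x) = t x" if "x \<in> P" for t x
    using that inj by (simp add: F_def inv_into_f_f)
  have "continuous_on ?K (\<lambda>t. F t y)" for y
    unfolding F_def by (cases "y \<in> f ` P") (auto intro: continuous_on_subset[OF continuous_on_product_coordinates])
  then have cF: "continuous_on ?K F" by (rule continuous_on_coordinatewise_then_product)
  have "continuous_on ?L (\<lambda>t. G t y)" for y
    unfolding G_def by (cases "y \<in> P") (auto intro: continuous_on_subset[OF continuous_on_product_coordinates])
  then have cG: "continuous_on ?L G" by (rule continuous_on_coordinatewise_then_product)
  have FL: "F t \<in> ?L" if t: "t \<in> ?K" for t
  proof -
    have "sum (F t) (f ` P) = sum t P"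
      using inj by (subst sum.reindex) (auto simp: Ff)
    moreover have supp: "y \<in> f ` P" if "F t y \<noteq> 0" for y
      using that by (auto simp: F_def split: if_splits)
    moreover have "F t y \<ge> 0" for y using t by (auto simp: F_def order_complex_def)
    moreover have "le' y z \<or> le' z y" if yz: "F t y \<noteq> 0" "F t z \<noteq> 0" for y z
    proof -
      obtain a b where "y = f a" "z = f b" "a \<in> P" "b \<in> P"
        using supp[OF yz(1)] supp[OF yz(2)] by blast
      then show ?thesis using yz t le by (auto simp: Ff order_complex_def)
    qed
    ultimately show ?thesis using t by (auto simp: order_complex_def)
  qed
  have GK: "G t \<in> ?K" if t: "t \<in> ?L" for t
  proof -
    have "sum (G t) P = sum t (f ` P)"
      using inj by (subst sum.reindex) (auto simp: G_def)
    moreover have "le x y \<or> le y x" if "G t x \<noteq> 0" "G t y \<noteq> 0" for x y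
      using that t le[of x y] le[of y x] by (auto simp: G_def order_complex_def split: if_splits)
    ultimately show ?thesis using t by (auto simp: order_complex_def G_def)
  qed
  have "G (F t) = t" if "t \<in> ?K" for t
    using that by (auto simp: G_def Ff order_complex_def fun_eq_iff)
  moreover have "F (G t) = t" if "t \<in> ?L" for t
  proof
    fix y show "F (G t) y = t y"
      using that by (cases "y \<in> f ` P") (auto simp: Ff G_def, auto simp: F_def order_complex_def)
  qed
  ultimately show ?thesis
    unfolding homeomorphic_space_def homeomorphic_maps_def
    using cF cG FL GK by (intro exI[of _ F] exI[of _ G]) auto
qed

lemma contractible_poset_iso:
  assumes "inj_on f P" "\<And>x y. x \<in> P \<Longrightarrow> y \<in> P \<Longrightarrow> le' (f x) (f y) \<longleftrightarrow> le x y"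
  shows "contractible_poset (f ` P) le' \<longleftrightarrow> contractible_poset P le"
  using homeomorphic_space_contractibility[OF order_complex_iso[of f P le' le]] assms
  by (simp add: contractible_poset_def)

section \<open>Mapping cylinders and fibres of monotone maps\<close>

fun mapping_cylinder_le ::
  "('a \<Rightarrow> 'b) \<Rightarrow> ('a \<Rightarrow> 'a \<Rightarrow> bool) \<Rightarrow> ('b \<Rightarrow> 'b \<Rightarrow> bool) \<Rightarrow> 'a + 'b \<Rightarrow> 'a + 'b \<Rightarrow> bool" where
  "mapping_cylinder_le f leX leY (Inl x) (Inl x') = leX x x'"
| "mapping_cylinder_le f leX leY (Inl x) (Inr y) = leY (f x) y"
| "mapping_cylinder_le f leX leY (Inr y) (Inl x) = False"
| "mapping_cylinder_le f leX leY (Inr y) (Inr y') = leY y y'"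

text \<open>Quillen's Theorem A, by way of the mapping cylinder. Above \<open>Inl x\<close> the copy
  of \<open>Y\<close> has the minimum \<open>Inr (f x)\<close>, so the cylinder retracts to
  \<open>Y\<close> and is contractible. Below \<open>Inr y\<close> the copy of \<open>X\<close> is
  the fibre over \<open>y\<close>, so by the dual criterion the cylinder also retracts to
  \<open>X\<close>.\<close>

proposition contractible_poset_fibres:
  assumes X: "finite X" "poset_on X leX" and Y: "finite Y" "poset_on Y leY"
    and fXY: "\<And>x. x \<in> X \<Longrightarrow> f x \<in> Y"
    and mono: "\<And>x x'. \<lbrakk>x \<in> X; x' \<in> X; leX x x'\<rbrakk> \<Longrightarrow> leY (f x) (f x')"
    and fib: "\<And>y. y \<in> Y \<Longrightarrow> contractible_poset {x\<in>X. leY (f x) y} leX"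
    and ctr: "contractible_poset Y leY"
  shows "contractible_poset X leX"
proof -
  define le where "le = mapping_cylinder_le f leX leY"
  have [simp]: "le (Inl x) (Inl x') = leX x x'" "le (Inl x) (Inr y) = leY (f x) y"
      "le (Inr y) (Inl x) = False" "le (Inr y) (Inr y') = leY y y'" for x x' y y'
    by (simp_all add: le_def)
  let ?M = "Inl ` X \<union> Inr ` Y"
  have fin: "finite ?M" using X Y by simp
  have po: "poset_on ?M le"
    unfolding poset_on_def
  proof (intro conjI ballI impI)
    show "le z z" if "z \<in> ?M" for z
      using that X(2) Y(2) by (auto intro: poset_on_refl)
    show "z = w" if "z \<in> ?M" "w \<in> ?M" "le z w \<and> le w z" for z w
      using that
      by (elim UnE imageE) (auto intro: poset_on_antisym[OF X(2)] poset_on_antisym[OF Y(2)])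
    have trX: "leX x z" if "x \<in> X" "y \<in> X" "z \<in> X" "leX x y" "leX y z" for x y z
      using poset_on_trans[OF X(2)] that by blast
    have trY: "leY x z" if "x \<in> Y" "y \<in> Y" "z \<in> Y" "leY x y" "leY y z" for x y z
      using poset_on_trans[OF Y(2)] that by blast
    show "le u w" if "u \<in> ?M" "v \<in> ?M" "w \<in> ?M" "le u v \<and> le v w" for u v w
      using that
      by (elim UnE imageE; simp) (blast intro: trX trY fXY mono)+
  qed
  have "strong_deformation_retract (order_complex ?M le) (order_complex (Inr ` Y) le)"
  proof (rule poset_inclusion_strong_deformation_retract[OF fin po])
    fix g assume "g \<in> ?M - Inr ` Y"
    then obtain x where x: "g = Inl x" "x \<in> X" by auto
    show "contractible_poset {z\<in>Inr ` Y. le g z} le"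
      by (rule contractible_poset_minimum[of _ "Inr (f x)"])
        (use x Y fXY poset_on_refl[OF Y(2)] in auto)
  qed auto
  moreover have "contractible_poset (Inr ` Y) le"
    using ctr by (subst contractible_poset_iso[where le = leY]) auto
  moreover have "strong_deformation_retract (order_complex ?M le) (order_complex (Inl ` X) le)"
  proof (rule poset_inclusion_strong_deformation_retract_dual[OF fin po])
    fix g assume "g \<in> ?M - Inl ` X"
    then obtain y where y: "g = Inr y" "y \<in> Y" by auto
    have "{z\<in>Inl ` X. le z g} = Inl ` {x\<in>X. leY (f x) y}" using y by auto
    moreover have "contractible_poset (Inl ` {x\<in>X. leY (f x) y}) le"
      using fib[OF y(2)] by (subst contractible_poset_iso[where le = leX]) auto
    ultimately show "contractible_poset {z\<in>Inl ` X. le z g} le" by simp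
  qed auto
  ultimately have "contractible (order_complex (Inl ` X) le)"
    using strong_deformation_retract_contractible unfolding contractible_poset_def by blast
  moreover have "X \<noteq> {}"
    using ctr fib by (auto simp: contractible_poset_def)
  ultimately have "contractible_poset (Inl ` X) le" by (simp add: contractible_poset_def)
  then show ?thesis by (subst (asm) contractible_poset_iso[where le = leX]) auto
qed

section \<open>Weighted complete directed graphs\<close>

lemma wcdgD:
  assumes "wcdg n A g" "g a b \<noteq> 0"
  shows "a \<in> A" "b \<in> A" "a \<noteq> b" "g a b \<le> n" "g b a = 0"
proof -
  show *: "a \<in> A" "b \<in> A" "a \<noteq> b" "g a b \<le> n"
    using assms unfolding wcdg_def by blast+
  show "g b a = 0" using assms * unfolding wcdg_def by blast
qed

lemma wcdg_total: "wcdg n A g \<Longrightarrow> a \<in> A \<Longrightarrow> b \<in> A \<Longrightarrow> a \<noteq> b \<Longrightarrow> g a b \<noteq> 0 \<or> g b a \<noteq> 0"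
  unfolding wcdg_def by blast

lemma wcdg_le: "wcdg n A g \<Longrightarrow> g a b \<le> n"
  using wcdgD(4)[of n A g a b] by (cases "g a b = 0") auto

lemma finite_wcdg:
  assumes "finite A"
  shows "finite {g. wcdg n A g}"
proof -
  let ?F = "{f. \<forall>b. (b \<in> A \<longrightarrow> f b \<in> {..n}) \<and> (b \<notin> A \<longrightarrow> f b = 0)}"
  have "finite ?F" using assms by (intro finite_set_of_finite_funs) auto
  then have "finite {g. \<forall>a. (a \<in> A \<longrightarrow> g a \<in> ?F) \<and> (a \<notin> A \<longrightarrow> g a = (\<lambda>_. 0))}"
    by (rule finite_set_of_finite_funs[OF assms])
  moreover have "{g. wcdg n A g} \<subseteq> {g. \<forall>a. (a \<in> A \<longrightarrow> g a \<in> ?F) \<and> (a \<notin> A \<longrightarrow> g a = (\<lambda>_. 0))}"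
    using wcdgD(1,2) wcdg_le by fastforce
  ultimately show ?thesis by (rule finite_subset[rotated])
qed

lemma graph_leD:
  "graph_le g h \<Longrightarrow> a \<noteq> b \<Longrightarrow> g a b \<noteq> 0 \<Longrightarrow>
    h a b \<noteq> 0 \<and> g a b \<le> h a b \<or> h b a \<noteq> 0 \<and> g a b < h b a"
  unfolding graph_le_def by blast

lemma graph_le_trans:
  assumes "graph_le f g" "graph_le g h"
  shows "graph_le f h"
  unfolding graph_le_def
proof (intro allI impI)
  fix a b assume ab: "a \<noteq> b \<and> f a b \<noteq> 0"
  then consider "g a b \<noteq> 0" "f a b \<le> g a b" | "g b a \<noteq> 0" "f a b < g b a"
    using graph_leD[OF assms(1)] by blast
  then show "h a b \<noteq> 0 \<and> f a b \<le> h a b \<or> h b a \<noteq> 0 \<and> f a b < h b a"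
    by cases (use ab graph_leD[OF assms(2), of a b] graph_leD[OF assms(2), of b a] in auto)
qed

lemma poset_on_graph_le: "poset_on {g. wcdg n A g} graph_le"
  unfolding poset_on_def
proof (intro conjI ballI impI)
  show "graph_le g g" for g by (simp add: graph_le_def)
  \<comment> \<open>Antisymmetry: if \<open>g a b\<close> exceeded \<open>h a b\<close>, then
    \<open>h\<close> would reverse this edge with a strictly larger weight, and passing back from
    \<open>h\<close> to \<open>g\<close> would require \<open>g a b\<close> to exceed that
    weight.\<close>
  have le: "g a b \<le> h a b" if "wcdg n A g" "wcdg n A h" "graph_le g h" "graph_le h g" for g h a b
  proof (rule ccontr)
    assume "\<not> g a b \<le> h a b"
    then have gab: "g a b \<noteq> 0" "\<not> g a b \<le> h a b" by auto
    have "a \<noteq> b" "g b a = 0" using wcdgD[OF that(1) gab(1)] by auto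
    then have "h b a \<noteq> 0" "g a b < h b a" using graph_leD[OF that(3), of a b] gab by auto
    then show False
      using graph_leD[OF that(4), of b a] \<open>a \<noteq> b\<close> \<open>g b a = 0\<close> by auto
  qed
  show "g = h" if "g \<in> {g. wcdg n A g}" "h \<in> {g. wcdg n A g}" "graph_le g h \<and> graph_le h g" for g h
    using le[of g h] le[of h g] that by (intro ext antisym) auto
  show "graph_le f h" if "graph_le f g \<and> graph_le g h" for f g h
    using that graph_le_trans by blast
qed

lemma wcdg_subset_finite_poset:
  assumes "finite A" "S \<subseteq> {h. wcdg n A h}"
  shows "finite S" "poset_on S graph_le"
  using finite_subset[OF assms(2) finite_wcdg[OF assms(1)]]
    poset_on_subset[OF poset_on_graph_le assms(2)] .

lemma Gn_subset_Gext: "Gn n A \<subseteq> Gext n A"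
proof -
  have "edges_of_weight g w \<subseteq> edges g" for g :: "'a \<Rightarrow> 'a \<Rightarrow> nat" and w
    by (auto simp: edges_of_weight_def edges_def)
  then show ?thesis unfolding Gn_def Gext_def using acyclic_subset by blast
qed

lemma Gn_wcdg: "h \<in> Gn n A \<Longrightarrow> wcdg n A h"
  by (simp add: Gn_def)

section \<open>Vertices without incoming edges of top weight\<close>

definition top_sources :: "nat \<Rightarrow> 'a set \<Rightarrow> ('a \<Rightarrow> 'a \<Rightarrow> nat) \<Rightarrow> 'a set" where
  "top_sources n A h = {x\<in>A. \<forall>y. h y x \<noteq> n}"

text \<open>The edges of weight \<open>n\<close> contain no cycle, so on the finite set
  \<open>A\<close> they form a well-founded relation, and \<open>A\<close> has a minimal vertex for
  it.\<close>

lemma top_sources_nonempty: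
  assumes "finite A" "A \<noteq> {}" "n \<ge> 1" "g \<in> Gext n A"
  shows "top_sources n A g \<noteq> {}"
proof -
  let ?r = "edges_of_weight g n"
  have g: "wcdg n A g" "acyclic ?r" using assms(4) by (auto simp: Gext_def)
  have "?r \<subseteq> A \<times> A" using wcdgD(1,2)[OF g(1)] by (auto simp: edges_of_weight_def)
  then have "wf ?r" using assms(1) g(2) by (meson finite_SigmaI finite_acyclic_wf finite_subset)
  then obtain x where "x \<in> A" "\<And>y. (y, x) \<in> ?r \<Longrightarrow> y \<notin> A"
    using assms(2) by (meson all_not_in_conv wfE_min)
  \<comment> \<open>As \<open>n\<close> is at least 1, the value \<open>n\<close> marks a genuine
    edge and not the absence of one.\<close>
  moreover have "(y, x) \<in> ?r" "y \<in> A" if "g y x = n" for y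
    using wcdgD(1)[OF g(1), of y x] that assms(3) by (auto simp: edges_of_weight_def)
  ultimately have "x \<in> top_sources n A g"
    unfolding top_sources_def by blast
  then show ?thesis by blast
qed

text \<open>No weight exceeds \<open>n\<close>, so an edge of weight \<open>n\<close> in
  \<open>g\<close> can be neither reversed nor made heavier in \<open>h\<close>: it is also an edge
  of weight \<open>n\<close> in \<open>h\<close>.\<close>

lemma top_sources_antimono:
  assumes "n \<ge> 1" "wcdg n A g" "wcdg n A h" "graph_le g h"
  shows "top_sources n A h \<subseteq> top_sources n A g"
proof
  fix x assume x: "x \<in> top_sources n A h"
  have "g y x \<noteq> n" for y
  proof
    assume yx: "g y x = n"
    then have "y \<noteq> x" using wcdgD(3)[OF assms(2), of y x] assms(1) by simp
    then have "n \<le> h y x \<or> n < h x y" using graph_leD[OF assms(4), of y x] yx assms(1) by auto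
    then have "h y x = n" using wcdg_le[OF assms(3), of y x] wcdg_le[OF assms(3), of x y] by auto
    then show False using x by (simp add: top_sources_def)
  qed
  then show "x \<in> top_sources n A g" using x by (simp add: top_sources_def)
qed

section \<open>Restrictions and ordinal sums of graphs\<close>

definition restrict_graph :: "('a \<Rightarrow> 'a \<Rightarrow> nat) \<Rightarrow> 'a set \<Rightarrow> 'a \<Rightarrow> 'a \<Rightarrow> nat" where
  "restrict_graph g I = (\<lambda>a b. if a \<in> I \<and> b \<in> I then g a b else 0)"

lemma restrict_graph_mono:
  assumes "graph_le g h"
  shows "graph_le (restrict_graph g I) (restrict_graph h I)"
  unfolding graph_le_def
proof (intro allI impI)
  fix a b assume "a \<noteq> b \<and> restrict_graph g I a b \<noteq> 0"
  then have "a \<in> I" "b \<in> I" "a \<noteq> b" "g a b \<noteq> 0"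
    by (auto simp: restrict_graph_def split: if_splits)
  then show "restrict_graph h I a b \<noteq> 0 \<and> restrict_graph g I a b \<le> restrict_graph h I a b \<or>
      restrict_graph h I b a \<noteq> 0 \<and> restrict_graph g I a b < restrict_graph h I b a"
    using graph_leD[OF assms, of a b] by (simp add: restrict_graph_def)
qed

text \<open>The new bound \<open>k\<close> is independent of \<open>n\<close>, because inside a set
  of top sources the weights are at most \<open>n - 1\<close>, and the induction uses this smaller
  bound.\<close>

lemma wcdg_restrict:
  assumes "wcdg n A g" "I \<subseteq> A" "\<And>a b. a \<in> I \<Longrightarrow> b \<in> I \<Longrightarrow> g a b \<le> k"
  shows "wcdg k I (restrict_graph g I)"
  unfolding wcdg_def
proof (intro conjI allI ballI impI)
  fix a b assume nz: "restrict_graph g I a b \<noteq> 0"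
  then show "a \<in> I" "b \<in> I" by (auto simp: restrict_graph_def split: if_splits)
  then show "a \<noteq> b" "restrict_graph g I a b \<le> k"
    using nz wcdgD(3)[OF assms(1), of a b] assms(3) by (auto simp: restrict_graph_def)
next
  fix a b assume "a \<in> I" "b \<in> I" "a \<noteq> b"
  then show "(restrict_graph g I a b \<noteq> 0) = (restrict_graph g I b a = 0)"
    using wcdgD(5)[OF assms(1), of a b] wcdg_total[OF assms(1), of a b] subsetD[OF assms(2)]
    by (auto simp: restrict_graph_def)
qed

lemma Gext_restrict:
  assumes "g \<in> Gext n A" "I \<subseteq> A" "\<And>a b. a \<in> I \<Longrightarrow> b \<in> I \<Longrightarrow> g a b \<le> k"
  shows "restrict_graph g I \<in> Gext k I"
proof -
  have "edges_of_weight (restrict_graph g I) w \<subseteq> edges_of_weight g w" for w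
    by (auto simp: edges_of_weight_def restrict_graph_def split: if_splits)
  then show ?thesis
    using assms wcdg_restrict[of n A g I k] acyclic_subset unfolding Gext_def by blast
qed

lemma Gn_restrict:
  assumes "h \<in> Gn n A" "I \<subseteq> A" "\<And>a b. a \<in> I \<Longrightarrow> b \<in> I \<Longrightarrow> h a b \<le> k"
  shows "restrict_graph h I \<in> Gn k I"
proof -
  have "edges (restrict_graph h I) \<subseteq> edges h"
    by (auto simp: edges_def restrict_graph_def split: if_splits)
  then show ?thesis
    using assms wcdg_restrict[of n A h I k] acyclic_subset unfolding Gn_def by blast
qed

definition ordinal_sum ::
  "nat \<Rightarrow> 'a set \<Rightarrow> 'a set \<Rightarrow> ('a \<Rightarrow> 'a \<Rightarrow> nat) \<Rightarrow> ('a \<Rightarrow> 'a \<Rightarrow> nat) \<Rightarrow> 'a \<Rightarrow> 'a \<Rightarrow> nat" where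
  "ordinal_sum n I B x y = (\<lambda>a b. if a \<in> I \<and> b \<in> I then x a b else if a \<in> B \<and> b \<in> B then y a b
     else if a \<in> I \<and> b \<in> B then n else 0)"

lemma Gn_ordinal_sum:
  assumes "n \<ge> 1" "x \<in> Gn (n - 1) I" "y \<in> Gn n B" "I \<inter> B = {}" "finite I" "finite B"
  shows "ordinal_sum n I B x y \<in> Gn n (I \<union> B)"
proof -
  let ?m = "ordinal_sum n I B x y"
  note wx = Gn_wcdg[OF assms(2)] and wy = Gn_wcdg[OF assms(3)]
  have xn: "x a b < n" for a b using wcdg_le[OF wx, of a b] assms(1) by simp
  have yn: "y a b \<le> n" for a b using wcdg_le[OF wy] .
  have disj: "a \<notin> B" if "a \<in> I" for a using that assms(4) by blast
  have "wcdg n (I \<union> B) ?m"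
    unfolding wcdg_def
  proof (intro conjI allI ballI impI)
    fix a b assume m: "?m a b \<noteq> 0"
    show "a \<in> I \<union> B" "b \<in> I \<union> B" using m by (auto simp: ordinal_sum_def split: if_splits)
    show "a \<noteq> b"
      using m wcdgD(3)[OF wx, of a b] wcdgD(3)[OF wy, of a b] disj
      by (auto simp: ordinal_sum_def split: if_splits)
    show "?m a b \<le> n" using xn[of a b] yn[of a b] by (auto simp: ordinal_sum_def)
  next
    fix a b assume ab: "a \<in> I \<union> B" "b \<in> I \<union> B" "a \<noteq> b"
    show "(?m a b \<noteq> 0) = (?m b a = 0)"
      using ab wcdgD(5)[OF wx, of a b] wcdgD(5)[OF wy, of a b] wcdg_total[OF wx, of a b]
        wcdg_total[OF wy, of a b] disj assms(1)
      by (auto simp: ordinal_sum_def)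
  qed
  moreover have "acyclic (edges ?m)"
  proof -
    have ex: "edges x \<subseteq> I \<times> I" and ey: "edges y \<subseteq> B \<times> B"
      using wcdgD(1,2)[OF wx] wcdgD(1,2)[OF wy] by (auto simp: edges_def)
    \<comment> \<open>On finite relations acyclicity and well-foundedness agree, and
      \<open>wf_Un\<close> glues the three pieces: no edge runs from \<open>B\<close> back to
      \<open>I\<close>, so the domain on the left of each union avoids the range on its
      right.\<close>
    have "wf (edges x)" "wf (edges y)"
      using assms finite_subset[OF ex] finite_subset[OF ey]
      by (auto simp: Gn_def intro!: finite_acyclic_wf)
    moreover have "acyclic (I \<times> B)"
      using assms(4) by (auto simp: acyclic_irrefl irrefl_def trans_def)
    then have "wf (I \<times> B)" using assms by (intro finite_acyclic_wf) auto
    ultimately have "wf (edges x \<union> I \<times> B \<union> edges y)"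
      using ex ey assms(4) by (intro wf_Un) blast+
    moreover have "edges ?m \<subseteq> edges x \<union> I \<times> B \<union> edges y"
      by (auto simp: edges_def ordinal_sum_def split: if_splits)
    ultimately show ?thesis using wf_acyclic wf_subset by blast
  qed
  ultimately show ?thesis by (simp add: Gn_def)
qed

text \<open>Between the blocks, an edge of \<open>h\<close> from \<open>I\<close> to
  \<open>B\<close> has weight at most \<open>n\<close>, and one from \<open>B\<close> to
  \<open>I\<close> has weight below \<open>n\<close>, so that reversing it with weight
  \<open>n\<close> is a strict increase. Inside the blocks the comparison is the one with
  \<open>x\<close> and \<open>y\<close>.\<close>

lemma graph_le_ordinal_sum:
  assumes "n \<ge> 1" "wcdg n (I \<union> B) h" "I \<inter> B = {}" "\<And>a b. b \<in> I \<Longrightarrow> h a b \<noteq> n"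
    and x: "graph_le (restrict_graph h I) x" and y: "graph_le (restrict_graph h B) y"
  shows "graph_le h (ordinal_sum n I B x y)"
  unfolding graph_le_def
proof (intro allI impI)
  fix a b assume ab: "a \<noteq> b \<and> h a b \<noteq> 0"
  let ?m = "ordinal_sum n I B x y"
  have disj: "a \<notin> B" if "a \<in> I" for a using that assms(3) by blast
  have "a \<in> I \<union> B" "b \<in> I \<union> B" "h a b \<le> n" using wcdgD[OF assms(2)] ab by auto
  then consider "a \<in> I" "b \<in> I" | "a \<in> I" "b \<in> B" | "a \<in> B" "b \<in> I" | "a \<in> B" "b \<in> B" by blast
  then show "?m a b \<noteq> 0 \<and> h a b \<le> ?m a b \<or> ?m b a \<noteq> 0 \<and> h a b < ?m b a"
  proof cases
    case 1
    then show ?thesis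
      using graph_leD[OF x, of a b] ab by (simp add: restrict_graph_def ordinal_sum_def)
  next
    case 2
    then show ?thesis using disj \<open>h a b \<le> n\<close> assms(1) by (auto simp: ordinal_sum_def)
  next
    case 3
    then have "h a b < n" using \<open>h a b \<le> n\<close> assms(4)[of b a] by simp
    then show ?thesis using 3 disj by (auto simp: ordinal_sum_def)
  next
    case 4
    then have "a \<notin> I" "b \<notin> I" using disj by blast+
    then show ?thesis
      using 4 graph_leD[OF y, of a b] ab by (simp add: restrict_graph_def ordinal_sum_def)
  qed
qed

section \<open>Contractibility of the acyclic graphs above a given graph\<close>

proposition contractible_Gn_above:
  assumes "finite A" "g \<in> Gext n A"
  shows "contractible_poset {h \<in> Gn n A. graph_le g h} graph_le"
  using assms
\<comment> \<open>The measure admits both smaller instances: weights up to \<open>n\<close> on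
  \<open>A - I\<close> with \<open>I\<close> nonempty, and weights up to \<open>n - 1\<close> on
  \<open>I\<close>, which may be all of \<open>A\<close>.\<close>
proof (induction "n + card A" arbitrary: n A g rule: less_induct)
  case less
  have wg: "wcdg n A g" using less.prems(2) by (simp add: Gext_def)
  have finS: "finite S" and poS: "poset_on S graph_le" if "S \<subseteq> Gn k B" "finite B" for S k and B :: "'a set"
  proof -
    have "S \<subseteq> {h. wcdg k B h}" using that Gn_wcdg by blast
    with that(2) show "finite S" "poset_on S graph_le"
      by (rule wcdg_subset_finite_poset)+
  qed
  show ?case
  \<comment> \<open>In the base case the zero function is the only candidate for a graph. For
    \<open>n = 0\<close> and at least two vertices there is no graph at all, but then no
    \<open>g\<close> is given either.\<close>
  proof (cases "n = 0 \<or> A = {}")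
    case True
    have zero: "h = (\<lambda>_ _. 0)" if "wcdg n A h" for h
      using True wcdgD[OF that] by (intro ext) force
    have "g \<in> Gn n A" using wg zero[OF wg] by (simp add: Gn_def edges_def acyclic_def)
    moreover have "graph_le g g" by (simp add: graph_le_def)
    moreover have "h = g" if "h \<in> Gn n A" for h
      using zero[OF wg] zero[OF Gn_wcdg[OF that]] by simp
    ultimately have "{h \<in> Gn n A. graph_le g h} = {g}" by blast
    then show ?thesis
      using \<open>graph_le g g\<close> contractible_poset_maximum[of "{g}" g graph_le] by simp
  next
    case False
    then have n: "n \<ge> 1" and "A \<noteq> {}" by auto
    let ?X = "{h \<in> Gn n A. graph_le g h}"
    let ?M = "top_sources n A g"
    let ?Y = "{I. I \<noteq> {} \<and> I \<subseteq> ?M}"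
    have "?M \<subseteq> A" by (auto simp: top_sources_def)
    then have finM: "finite ?M" using less.prems(1) by (rule finite_subset)
    show ?thesis
    \<comment> \<open>Reverse inclusion on \<open>?Y\<close> makes the passage to top sources
      monotone. The fibre over \<open>I\<close> consists of the graphs with \<open>I\<close> among
      their top sources, and \<open>?M\<close> is the minimum of \<open>?Y\<close>.\<close>
    proof (rule contractible_poset_fibres[where f = "top_sources n A" and Y = ?Y and leY = "\<lambda>I I'. I' \<subseteq> I"])
      show "finite ?X" "poset_on ?X graph_le"
        by (rule finS[of _ n A] poS[of _ n A]; use less.prems(1) in blast)+
      show "finite ?Y" using finM by simp
      show "poset_on ?Y (\<lambda>I I'. I' \<subseteq> I)" unfolding poset_on_def by blast
      show "top_sources n A h \<in> ?Y" if h: "h \<in> ?X" for h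
        using top_sources_nonempty[OF less.prems(1) \<open>A \<noteq> {}\<close> n, of h]
          top_sources_antimono[OF n wg Gn_wcdg, of h] h Gn_subset_Gext by blast
      show "top_sources n A h' \<subseteq> top_sources n A h" if "h \<in> ?X" "h' \<in> ?X" "graph_le h h'" for h h'
        using top_sources_antimono[OF n Gn_wcdg Gn_wcdg] that by blast
      show "contractible_poset ?Y (\<lambda>I I'. I' \<subseteq> I)"
        using finM top_sources_nonempty[OF less.prems(1) \<open>A \<noteq> {}\<close> n less.prems(2)]
        by (intro contractible_poset_minimum[where m = ?M]) auto
    next
      fix I assume I: "I \<in> ?Y"
      let ?B = "A - I"
      let ?XI = "{h \<in> ?X. I \<subseteq> top_sources n A h}"
      let ?Z = "{y \<in> Gn n ?B. graph_le (restrict_graph g ?B) y}"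
      let ?W = "{x \<in> Gn (n - 1) I. graph_le (restrict_graph g I) x}"
      have IA: "I \<subseteq> A" "I \<noteq> {}" "I \<subseteq> ?M" using I \<open>?M \<subseteq> A\<close> by auto
      have fin: "finite I" "finite ?B" using IA less.prems(1) by (auto intro: finite_subset)
      \<comment> \<open>No edge of weight \<open>n\<close> ends in \<open>I\<close>, so the bound
        drops by one there. This applies to \<open>g\<close> as well, since \<open>I\<close> is
        contained in \<open>?M\<close>.\<close>
      have lt: "h a b \<le> n - 1" if "wcdg n A h" "I \<subseteq> top_sources n A h" "b \<in> I" for h a b
        using wcdg_le[OF that(1), of a b] that(2,3) by (auto simp: top_sources_def le_less)
      have "card ?B < card A" using IA less.prems(1) by (intro psubset_card_mono) auto
      then have ctrZ: "contractible_poset ?Z graph_le"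
        using less.prems fin wcdg_le[OF wg]
        by (intro less.hyps Gext_restrict) auto
      have "card I \<le> card A" using IA less.prems(1) by (intro card_mono)
      then have ctrW: "contractible_poset ?W graph_le"
        using less.prems fin n lt[OF wg] IA
        by (intro less.hyps Gext_restrict[where n = n and A = A]) auto
      show "contractible_poset ?XI graph_le"
      \<comment> \<open>Restriction to \<open>?B\<close> and, within its fibres, restriction to
        \<open>I\<close> leave the graphs whose two restrictions are bounded by a given
        \<open>y\<close> and a given \<open>x\<close>.\<close>
      proof (rule contractible_poset_fibres[where f = "\<lambda>h. restrict_graph h ?B" and Y = ?Z and leY = graph_le])
        show "finite ?XI" "poset_on ?XI graph_le"
          by (rule finS[of _ n A] poS[of _ n A]; use less.prems(1) in blast)+
        show "finite ?Z" "poset_on ?Z graph_le"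
          by (rule finS[of _ n ?B] poS[of _ n ?B]; use fin in blast)+
        show "restrict_graph h ?B \<in> ?Z" if "h \<in> ?XI" for h
          using that Gn_restrict[of h n A ?B n] wcdg_le[OF Gn_wcdg, of h n A]
          by (auto intro: restrict_graph_mono)
        show "graph_le (restrict_graph h ?B) (restrict_graph h' ?B)" if "graph_le h h'" for h h'
          using that by (rule restrict_graph_mono)
      next
        fix y assume y: "y \<in> ?Z"
        let ?Xy = "{h \<in> ?XI. graph_le (restrict_graph h ?B) y}"
        show "contractible_poset ?Xy graph_le"
        proof (rule contractible_poset_fibres[where f = "\<lambda>h. restrict_graph h I" and Y = ?W and leY = graph_le])
          show "finite ?Xy" "poset_on ?Xy graph_le"
            by (rule finS[of _ n A] poS[of _ n A]; use less.prems(1) in blast)+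
          show "finite ?W" "poset_on ?W graph_le"
            by (rule finS[of _ "n - 1" I] poS[of _ "n - 1" I]; use fin in blast)+
          show "restrict_graph h I \<in> ?W" if "h \<in> ?Xy" for h
            using that Gn_restrict[of h n A I "n - 1"] lt[OF Gn_wcdg, of h] IA(1)
            by (auto intro: restrict_graph_mono)
          show "graph_le (restrict_graph h I) (restrict_graph h' I)" if "graph_le h h'" for h h'
            using that by (rule restrict_graph_mono)
        next
          fix x assume x: "x \<in> ?W"
          \<comment> \<open>The maximum of the remaining fibre: all edges between the blocks leave
            \<open>I\<close> with the greatest weight, which keeps \<open>I\<close> free of incoming
            edges of weight \<open>n\<close>.\<close>
          let ?m = "ordinal_sum n I ?B x y"
          have IB: "I \<union> ?B = A" "I \<inter> ?B = {}" using IA by auto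
          have wx: "wcdg (n - 1) I x" and wy: "wcdg n ?B y" using x y Gn_wcdg by auto
          \<comment> \<open>Stated without acyclicity of \<open>h\<close>, so that it also covers
            \<open>g\<close> and shows that \<open>?m\<close> lies above \<open>g\<close>.\<close>
          have le: "graph_le h ?m" if "wcdg n A h" "I \<subseteq> top_sources n A h"
            "graph_le (restrict_graph h I) x" "graph_le (restrict_graph h ?B) y" for h
            by (rule graph_le_ordinal_sum[OF n]) (use that IB in \<open>auto simp: top_sources_def\<close>)
          have "?m \<in> Gn n A"
            using Gn_ordinal_sum[OF n _ _ IB(2) fin] x y IB(1) by auto
          moreover have "graph_le g ?m" using le[OF wg IA(3)] x y by simp
          moreover have "?m a b \<noteq> n" if "b \<in> I" for a b
            using that wcdg_le[OF wx, of a b] n by (auto simp: ordinal_sum_def)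
          then have "I \<subseteq> top_sources n A ?m" using IA by (auto simp: top_sources_def)
          moreover have "restrict_graph ?m ?B = y"
            using wcdgD(1,2)[OF wy] by (force simp: restrict_graph_def ordinal_sum_def fun_eq_iff)
          moreover have "restrict_graph ?m I = x"
            using wcdgD(1,2)[OF wx] by (force simp: restrict_graph_def ordinal_sum_def fun_eq_iff)
          ultimately have "?m \<in> {h \<in> ?Xy. graph_le (restrict_graph h I) x}"
            by (simp add: graph_le_def)
          moreover have "finite {h \<in> ?Xy. graph_le (restrict_graph h I) x}"
            by (rule finS[of _ n A]; use less.prems(1) in blast)
          ultimately show "contractible_poset {h \<in> ?Xy. graph_le (restrict_graph h I) x} graph_le"
            by (intro contractible_poset_maximum[where m = ?m]) (auto intro: le Gn_wcdg)
        qed (rule ctrW)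
      qed (rule ctrZ)
    qed
  qed
qed

theorem theorem4:
  fixes n :: nat and A :: "'a set"
  assumes "n \<ge> 1" and "finite A"
  shows "weak_homotopy_equivalence
           (classifying_space (Gn n A) graph_le)
           (classifying_space (Gext n A) graph_le)
           (\<lambda>t. t)"
  unfolding classifying_space_eq
\<comment> \<open>The inclusion criterion reduces the claim to contractibility of the sets
  \<open>{x \<in> Gn n A. graph_le g x}\<close> for \<open>g\<close> outside
  \<open>Gn n A\<close>.\<close>
proof (intro strong_deformation_retract_weak_homotopy_equivalence poset_inclusion_strong_deformation_retract)
  have "Gext n A \<subseteq> {h. wcdg n A h}" by (auto simp: Gext_def)
  with assms(2) show "finite (Gext n A)" "poset_on (Gext n A) graph_le"
    by (rule wcdg_subset_finite_poset)+
  show "contractible_poset {x \<in> Gn n A. graph_le g x} graph_le" if "g \<in> Gext n A - Gn n A" for g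
    using contractible_Gn_above assms(2) that by blast
qed (rule Gn_subset_Gext)

end
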